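(* Let $G$ be a mixed graph on $n$ vertices and let $r,s$ be real numbers. Then $G$ is $(r,s)$-regular if and only if $r+s$ and $r-s$ are eigenvalues of the integrated adjacency matrix $\mathcal{I}(G)$ with corresponding eigenvectors $\mathbf{1}_{2n}$ and $\begin{bmatrix}\mathbf{1}_n^T & -\mathbf{1}_n^T\end{bmatrix}^T$, respectively.
   Context: A mixed graph $G$ has a finite nonempty vertex set $V_G=\{v_1,\dots,v_n\}$, a finite set $E_G$ of (undirected) edges, each joining an unordered pair of vertices $\{u,v\}$ (a loop if $u=v$), and a finite set $\vec E_G$ of arcs, each going from $u$ to $v$ for an ordered pair $(u,v)$ of vertices (a directed loop if $u=v$); multiple edges, loops, arcs and directed loops are allowed. The integrated adjacency matrix $\mathcal{I}(G)$, with rows and columns indexed by $v'_1,\dots,v'_n,v''_1,\dots,v''_n$ in this order, is the real symmetric $2n\times 2n$ matrix $\begin{bmatrix}A&D\\ D^T&A\end{bmatrix}$, where $A_{ij}$ ($i\neq j$) is the number of edges joining $v_i$ and $v_j$, $A_{ii}$ is twice the number of loops at $v_i$, and $D_{ij}$ is the number of arcs from $v_i$ to $v_j$. The undirected degree $d(u)$ is the number of edges incident with $u$, each loop at $u$ being counted twice. The out-degree $d^+(u)$ is the number of arcs starting at $u$ and the in-degree $d^-(u)$ is the number of arcs ending at $u$ (each directed loop at $u$ counts once in each). $G$ is $(r,s)$-regular if $d(u)=r$ and $d^+(u)=d^-(u)=s$ for all $u\in V_G$. $\mathbf{1}_m$ is the all-ones column vector of size $m$. *)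

theory Defs
  imports
    "HOL-Library.Uprod"
    "Graph_Theory.Digraph"
    "Jordan_Normal_Form.Matrix"
    "Jordan_Normal_Form.Char_Poly"
begin

text \<open>
  A mixed graph is a multi-digraph (vertices, arcs, tails and heads) together with a set of
  undirected edges on the same vertices.  Arcs and edges are abstract identifiers, so parallel
  ones are possible; an edge with ends \<open>Upair v v\<close> is a loop.
\<close>

record ('v, 'a, 'e) mixed_graph =
  arc_digraph :: "('v, 'a) pre_digraph"
  edges :: "'e set"
  ends :: "'e \<Rightarrow> 'v uprod"

abbreviation vertices :: "('v, 'a, 'e) mixed_graph \<Rightarrow> 'v set" where
  "vertices G \<equiv> verts (arc_digraph G)"

definition is_mixed_graph :: "('v, 'a, 'e) mixed_graph \<Rightarrow> bool" where
  "is_mixed_graph G \<longleftrightarrow>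
     fin_digraph (arc_digraph G) \<and> vertices G \<noteq> {} \<and>
     finite (edges G) \<and> (\<forall>e \<in> edges G. set_uprod (ends G e) \<subseteq> vertices G)"

definition num_edges :: "('v, 'a, 'e) mixed_graph \<Rightarrow> 'v \<Rightarrow> 'v \<Rightarrow> nat" where
  "num_edges G u v = card {e \<in> edges G. ends G e = Upair u v}"

definition num_arcs :: "('v, 'a, 'e) mixed_graph \<Rightarrow> 'v \<Rightarrow> 'v \<Rightarrow> nat" where
  "num_arcs G u v =
     card {a \<in> arcs (arc_digraph G). tail (arc_digraph G) a = u \<and> head (arc_digraph G) a = v}"

text \<open>The second summand counts every loop at \<open>u\<close> a second time.\<close>

definition und_degree :: "('v, 'a, 'e) mixed_graph \<Rightarrow> 'v \<Rightarrow> nat" where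
  "und_degree G u = card {e \<in> edges G. u \<in> set_uprod (ends G e)} + num_edges G u u"

definition regular_mixed :: "('v, 'a, 'e) mixed_graph \<Rightarrow> real \<Rightarrow> real \<Rightarrow> bool" where
  "regular_mixed G r s \<longleftrightarrow>
     (\<forall>u \<in> vertices G. real (und_degree G u) = r \<and>
        real (out_degree (arc_digraph G) u) = s \<and> real (in_degree (arc_digraph G) u) = s)"

text \<open>
  The matrices depend on the order in which the vertices are listed; \<open>vs\<close> is meant to be a
  repetition-free list of all vertices.
\<close>

definition adj_block :: "('v, 'a, 'e) mixed_graph \<Rightarrow> 'v list \<Rightarrow> real mat" where
  "adj_block G vs = mat (length vs) (length vs) (\<lambda>(i, j).
     if i = j then 2 * real (num_edges G (vs ! i) (vs ! i))
     else real (num_edges G (vs ! i) (vs ! j)))"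

definition arc_block :: "('v, 'a, 'e) mixed_graph \<Rightarrow> 'v list \<Rightarrow> real mat" where
  "arc_block G vs = mat (length vs) (length vs) (\<lambda>(i, j). real (num_arcs G (vs ! i) (vs ! j)))"

definition integrated_adjacency :: "('v, 'a, 'e) mixed_graph \<Rightarrow> 'v list \<Rightarrow> real mat" where
  "integrated_adjacency G vs =
     four_block_mat (adj_block G vs) (arc_block G vs) (transpose_mat (arc_block G vs)) (adj_block G vs)"

definition ones_vec :: "nat \<Rightarrow> real vec" where
  "ones_vec m = vec m (\<lambda>_. 1)"

end

theory Submission
  imports Defs
begin

text \<open>
  Write \<open>A\<close> and \<open>D\<close> for the two blocks.  The row sums of \<open>A\<close> are the undirected degrees, the row
  sums of \<open>D\<close> the out-degrees and the column sums of \<open>D\<close> the in-degrees (\<open>adj_block_mult_ones\<close>,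
  \<open>arc_block_mult_ones\<close>, \<open>transpose_arc_block_mult_ones\<close>).  Hence multiplying
  \<open>\<one> @\<^sub>v \<sigma> \<cdot>\<^sub>v \<one>\<close> by the integrated adjacency matrix gives \<open>d(u) + \<sigma> d\<^sup>+(u)\<close> in
  the upper half and \<open>d\<^sup>-(u) + \<sigma> d(u)\<close> in the lower half, and the eigenvector equation is a pair
  of linear equations at each vertex (\<open>eigenvector_signed_ones_iff\<close>).  The two vectors in question
  are the cases \<open>\<sigma> = 1\<close> and \<open>\<sigma> = -1\<close>; at each vertex they give
  \<open>d + d\<^sup>+ = d + d\<^sup>- = r + s\<close> and \<open>d - d\<^sup>+ = d - d\<^sup>- = r - s\<close>, a linear system
  whose only solution is \<open>d = r\<close>, \<open>d\<^sup>+ = d\<^sup>- = s\<close>.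
\<close>

text \<open>
  An edge at \<open>u\<close> has exactly one other end, so it is counted for exactly one \<open>v\<close>; a loop at \<open>u\<close> is
  counted for \<open>v = u\<close> only, and just once.
\<close>

lemma sum_num_edges:
  assumes "is_mixed_graph G"
  shows "(\<Sum>v\<in>vertices G. num_edges G u v) = card {e \<in> edges G. u \<in> set_uprod (ends G e)}"
proof -
  let ?E = "{e \<in> edges G. u \<in> set_uprod (ends G e)}"
  from assms have fin: "finite (vertices G)" "finite (edges G)"
    and inside: "\<forall>e \<in> edges G. set_uprod (ends G e) \<subseteq> vertices G"
    by (auto simp: is_mixed_graph_def fin_digraph.finite_verts)
  have other_end: "card {v \<in> vertices G. ends G e = Upair u v} = 1" if e: "e \<in> ?E" for e
  proof -
    obtain w where w: "ends G e = Upair u w"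
      using e by (cases "ends G e") (auto simp: Upair_inject)
    then have "{v \<in> vertices G. ends G e = Upair u v} = {w}"
      using e inside by auto
    then show ?thesis by simp
  qed
  have "(\<Sum>v\<in>vertices G. num_edges G u v) = (\<Sum>v\<in>vertices G. card {e \<in> ?E. ends G e = Upair u v})"
    unfolding num_edges_def by (intro sum.cong refl arg_cong[where f = card]) auto
  also have "\<dots> = 1 * card ?E"
    by (rule sum_multicount) (use fin other_end in auto)
  finally show ?thesis by simp
qed

lemma sum_num_arcs_out:
  assumes "fin_digraph (arc_digraph G)"
  shows "(\<Sum>v\<in>vertices G. num_arcs G u v) = out_degree (arc_digraph G) u"
proof -
  interpret fin_digraph "arc_digraph G" by fact
  let ?O = "out_arcs (arc_digraph G) u"
  have "(\<Sum>v\<in>vertices G. num_arcs G u v)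
      = (\<Sum>v\<in>vertices G. card {a \<in> ?O. v = head (arc_digraph G) a})"
    unfolding num_arcs_def by (intro sum.cong refl arg_cong[where f = card]) auto
  also have "\<dots> = 1 * card ?O"
  proof (rule sum_multicount)
    show "\<forall>a\<in>?O. card {v \<in> vertices G. v = head (arc_digraph G) a} = 1"
    proof
      fix a assume "a \<in> ?O"
      then have "{v \<in> vertices G. v = head (arc_digraph G) a} = {head (arc_digraph G) a}"
        by auto
      then show "card {v \<in> vertices G. v = head (arc_digraph G) a} = 1" by simp
    qed
  qed auto
  finally show ?thesis by (simp add: out_degree_def)
qed

lemma sum_num_arcs_in:
  assumes "fin_digraph (arc_digraph G)"
  shows "(\<Sum>v\<in>vertices G. num_arcs G v u) = in_degree (arc_digraph G) u"
proof -
  interpret fin_digraph "arc_digraph G" by fact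
  let ?I = "in_arcs (arc_digraph G) u"
  have "(\<Sum>v\<in>vertices G. num_arcs G v u)
      = (\<Sum>v\<in>vertices G. card {a \<in> ?I. v = tail (arc_digraph G) a})"
    unfolding num_arcs_def by (intro sum.cong refl arg_cong[where f = card]) auto
  also have "\<dots> = 1 * card ?I"
  proof (rule sum_multicount)
    show "\<forall>a\<in>?I. card {v \<in> vertices G. v = tail (arc_digraph G) a} = 1"
    proof
      fix a assume "a \<in> ?I"
      then have "{v \<in> vertices G. v = tail (arc_digraph G) a} = {tail (arc_digraph G) a}"
        by auto
      then show "card {v \<in> vertices G. v = tail (arc_digraph G) a} = 1" by simp
    qed
  qed auto
  finally show ?thesis by (simp add: in_degree_def)
qed

lemma sum_nth_distinct:
  assumes "distinct vs"
  shows "(\<Sum>i = 0..<length vs. f (vs ! i)) = (\<Sum>v\<in>set vs. f v)"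
  by (rule sum.reindex_bij_betw) (use assms in \<open>auto intro: bij_betw_nth\<close>)

lemma adj_block_mult_ones:
  assumes "is_mixed_graph G" and "distinct vs" and "set vs = vertices G"
  shows "adj_block G vs *\<^sub>v ones_vec (length vs)
    = vec (length vs) (\<lambda>i. real (und_degree G (vs ! i)))"
proof (rule eq_vecI)
  fix i assume "i < dim_vec (vec (length vs) (\<lambda>i. real (und_degree G (vs ! i))))"
  then have i: "i < length vs" by simp
  let ?u = "vs ! i"
  \<comment> \<open>Off the diagonal the entry is the number of edges; on it, the loops occur one more time.\<close>
  have "(adj_block G vs *\<^sub>v ones_vec (length vs)) $ i
      = (\<Sum>j = 0..<length vs. real (num_edges G ?u (vs ! j))
          + (if i = j then real (num_edges G ?u ?u) else 0))"
    using i by (auto simp: adj_block_def ones_vec_def scalar_prod_def intro!: sum.cong)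
  also have "\<dots> = (\<Sum>j = 0..<length vs. real (num_edges G ?u (vs ! j))) + real (num_edges G ?u ?u)"
    using i by (simp add: sum.distrib)
  also have "\<dots> = real (\<Sum>v\<in>vertices G. num_edges G ?u v) + real (num_edges G ?u ?u)"
    using sum_nth_distinct[OF assms(2), of "\<lambda>v. real (num_edges G ?u v)"] assms(3) by simp
  also have "\<dots> = real (und_degree G ?u)"
    using sum_num_edges[OF assms(1), of ?u] by (simp add: und_degree_def)
  finally show "(adj_block G vs *\<^sub>v ones_vec (length vs)) $ i
      = vec (length vs) (\<lambda>i. real (und_degree G (vs ! i))) $ i"
    using i by simp
qed (simp add: adj_block_def)

lemma arc_block_mult_ones:
  assumes "fin_digraph (arc_digraph G)" and "distinct vs" and "set vs = vertices G"
  shows "arc_block G vs *\<^sub>v ones_vec (length vs)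
    = vec (length vs) (\<lambda>i. real (out_degree (arc_digraph G) (vs ! i)))"
proof (rule eq_vecI)
  fix i assume "i < dim_vec (vec (length vs) (\<lambda>i. real (out_degree (arc_digraph G) (vs ! i))))"
  then show "(arc_block G vs *\<^sub>v ones_vec (length vs)) $ i
      = vec (length vs) (\<lambda>i. real (out_degree (arc_digraph G) (vs ! i))) $ i"
    using sum_nth_distinct[OF assms(2), of "\<lambda>v. real (num_arcs G (vs ! i) v)"] assms(3)
    by (simp add: arc_block_def ones_vec_def scalar_prod_def
        sum_num_arcs_out[OF assms(1), symmetric])
qed (simp add: arc_block_def)

lemma transpose_arc_block_mult_ones:
  assumes "fin_digraph (arc_digraph G)" and "distinct vs" and "set vs = vertices G"
  shows "transpose_mat (arc_block G vs) *\<^sub>v ones_vec (length vs)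
    = vec (length vs) (\<lambda>i. real (in_degree (arc_digraph G) (vs ! i)))"
proof (rule eq_vecI)
  fix i assume "i < dim_vec (vec (length vs) (\<lambda>i. real (in_degree (arc_digraph G) (vs ! i))))"
  then show "(transpose_mat (arc_block G vs) *\<^sub>v ones_vec (length vs)) $ i
      = vec (length vs) (\<lambda>i. real (in_degree (arc_digraph G) (vs ! i))) $ i"
    using sum_nth_distinct[OF assms(2), of "\<lambda>v. real (num_arcs G v (vs ! i))"] assms(3)
    by (simp add: arc_block_def ones_vec_def scalar_prod_def
        sum_num_arcs_in[OF assms(1), symmetric])
qed (simp add: arc_block_def)

text \<open>
  Leaving the scalar \<open>\<sigma>\<close> on the lower half arbitrary lets one computation serve both vectors of the
  theorem.  The vector is nonzero because a mixed graph has a vertex.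
\<close>

lemma eigenvector_signed_ones_iff:
  fixes G :: "('v, 'a, 'e) mixed_graph" and \<sigma> k :: real
  assumes G: "is_mixed_graph G" and vs: "distinct vs" "set vs = vertices G"
  shows "eigenvector (integrated_adjacency G vs)
      (ones_vec (length vs) @\<^sub>v \<sigma> \<cdot>\<^sub>v ones_vec (length vs)) k \<longleftrightarrow>
    (\<forall>u \<in> vertices G.
      real (und_degree G u) + \<sigma> * real (out_degree (arc_digraph G) u) = k \<and>
      real (in_degree (arc_digraph G) u) + \<sigma> * real (und_degree G u) = \<sigma> * k)"
    (is "eigenvector ?M ?x k \<longleftrightarrow> ?R")
proof -
  define n where "n = length vs"
  have fin: "fin_digraph (arc_digraph G)" using G by (simp add: is_mixed_graph_def)
  have "n > 0" using G vs(2) by (auto simp: is_mixed_graph_def n_def)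
  have carrier: "adj_block G vs \<in> carrier_mat n n" "arc_block G vs \<in> carrier_mat n n"
      "transpose_mat (arc_block G vs) \<in> carrier_mat n n" "ones_vec n \<in> carrier_vec n"
    by (auto simp: adj_block_def arc_block_def ones_vec_def n_def)
  have dim: "dim_row ?M = n + n"
    using carrier by (simp add: integrated_adjacency_def)
  have x: "?x = ones_vec n @\<^sub>v \<sigma> \<cdot>\<^sub>v ones_vec n" by (simp add: n_def)
  have x_carrier: "?x \<in> carrier_vec (n + n)"
    unfolding x using carrier by (intro append_carrier_vec) auto
  have "?x $ 0 = 1" unfolding x using \<open>n > 0\<close> by (simp add: ones_vec_def)
  then have x_nonzero: "?x \<noteq> 0\<^sub>v (n + n)" using \<open>n > 0\<close> by auto
  have product: "?M *\<^sub>v ?x =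
      vec n (\<lambda>i. real (und_degree G (vs ! i)) + \<sigma> * real (out_degree (arc_digraph G) (vs ! i))) @\<^sub>v
      vec n (\<lambda>i. real (in_degree (arc_digraph G) (vs ! i)) + \<sigma> * real (und_degree G (vs ! i)))"
    unfolding x integrated_adjacency_def
    using carrier adj_block_mult_ones[OF G vs] arc_block_mult_ones[OF fin vs]
      transpose_arc_block_mult_ones[OF fin vs]
    by (subst four_block_mat_mult_vec[where ?nr1.0 = n and ?nc1.0 = n and ?nr2.0 = n and ?nc2.0 = n])
      (auto simp: mult_mat_vec[where nr = n and nc = n] n_def[symmetric])
  have scaled: "k \<cdot>\<^sub>v ?x = vec n (\<lambda>i. k) @\<^sub>v vec n (\<lambda>i. \<sigma> * k)"
    unfolding x by (rule eq_vecI) (auto simp: ones_vec_def)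
  have "eigenvector ?M ?x k \<longleftrightarrow> ?M *\<^sub>v ?x = k \<cdot>\<^sub>v ?x"
    using x_carrier x_nonzero by (simp add: eigenvector_def dim)
  also have "\<dots> \<longleftrightarrow> (\<forall>i < n.
      real (und_degree G (vs ! i)) + \<sigma> * real (out_degree (arc_digraph G) (vs ! i)) = k \<and>
      real (in_degree (arc_digraph G) (vs ! i)) + \<sigma> * real (und_degree G (vs ! i)) = \<sigma> * k)"
    unfolding product scaled by (subst append_vec_eq[where n = n]) (auto simp: vec_eq_iff)
  also have "\<dots> \<longleftrightarrow> ?R"
    unfolding n_def vs(2)[symmetric] all_set_conv_all_nth by blast
  finally show ?thesis .
qed

theorem theorem5p1:
  fixes G :: "('v, 'a, 'e) mixed_graph" and vs :: "'v list" and n :: nat and r s :: real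
  assumes "is_mixed_graph G"
    and "distinct vs" and "set vs = vertices G" and "length vs = n"
  shows "regular_mixed G r s \<longleftrightarrow>
    eigenvector (integrated_adjacency G vs) (ones_vec (2 * n)) (r + s) \<and>
    eigenvector (integrated_adjacency G vs) (ones_vec n @\<^sub>v - ones_vec n) (r - s)"
proof -
  have plus: "ones_vec (2 * n) = ones_vec n @\<^sub>v 1 \<cdot>\<^sub>v ones_vec n"
    by (rule eq_vecI) (auto simp: ones_vec_def)
  have minus: "ones_vec n @\<^sub>v - ones_vec n = ones_vec n @\<^sub>v (- 1) \<cdot>\<^sub>v ones_vec n"
    by (rule eq_vecI) (auto simp: ones_vec_def)
  \<comment> \<open>Adding and subtracting the equations of the two eigenvectors isolates the three degrees.\<close>
  have solve: "d = r \<and> p = s \<and> m = s \<longleftrightarrow>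
      (d + 1 * p = r + s \<and> m + 1 * d = 1 * (r + s)) \<and>
      (d + (- 1) * p = r - s \<and> m + (- 1) * d = (- 1) * (r - s))" for d p m :: real
    by (simp, linarith)
  note iff = eigenvector_signed_ones_iff[OF assms(1-3), unfolded assms(4)]
  show ?thesis
    unfolding plus minus iff regular_mixed_def ball_conj_distrib[symmetric] solve ..
qed

end
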